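(* Let $\mathcal{A}$ be an infinite set. The collection of generalized cylinder sets $$\{ Z(x,F) : x \in \Sigma_{\mathcal{A}}^{\mathrm{fin}} \text{ and } F \subseteq \mathcal{A} \text{ is a finite subset} \}$$ is a basis for the topology of $\Sigma_{\mathcal{A}}$ consisting of compact open subsets. In addition, if $x \in \Sigma_{\mathcal{A}}$ and $l(x) = \infty$, then a neighborhood base for $x$ is given by $$\{ Z(x_1 \ldots x_n) : n \in \mathbb{N} \},$$ and if $x \in \Sigma_{\mathcal{A}}$ and $l(x) < \infty$, then a neighborhood base for $x$ is given by $$\{ Z(x,F) : F \text{ is a finite subset of } \mathcal{A} \}.$$
   Context: Let $\mathcal{A}$ be an infinite set and $\mathbb{N}=\{1,2,3,\ldots\}$. Put $\mathcal{A}^0=\{\vec{0}\}$ where $\vec{0}$ is the empty sequence, let $\mathcal{A}^k$ be the $k$-fold product for $k\in\mathbb{N}$, let $\mathcal{A}^{\mathbb{N}}=\mathcal{A}\times\mathcal{A}\times\cdots$, and let $\Sigma_{\mathcal{A}}:=\mathcal{A}^{\mathbb{N}}\sqcup\bigcup_{k=0}^\infty\mathcal{A}^k$ and $\Sigma_{\mathcal{A}}^{\mathrm{fin}}:=\bigcup_{k=0}^\infty\mathcal{A}^k$. The length is $l(x)=\infty$ for $x\in\mathcal{A}^{\mathbb{N}}$ and $l(x)=k$ for $x\in\mathcal{A}^k$; entries are written $x=x_1x_2\ldots$. Topology: give $\mathcal{A}$ the discrete topology and let $\mathcal{A}_\infty=\mathcal{A}\cup\{\infty\}$ be its one-point compactification.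 Let $X_{\mathcal{A}}=\mathcal{A}_\infty\times\mathcal{A}_\infty\times\cdots$ with the product topology. Define $Q:X_{\mathcal{A}}\to\Sigma_{\mathcal{A}}$ by truncating a sequence just before the first occurrence of $\infty$: $Q(x_1x_2\ldots)=\vec{0}$ if $x_1=\infty$; $Q(x_1x_2\ldots)=x_1\ldots x_n$ if $x_{n+1}=\infty$ and $x_i\neq\infty$ for $1\le i\le n$; and $Q(x_1x_2\ldots)=x_1x_2\ldots$ if no $x_i$ equals $\infty$. The space $\Sigma_{\mathcal{A}}$ has the quotient topology induced by $Q$. For $x\in\Sigma_{\mathcal{A}}^{\mathrm{fin}}$ and $y\in\Sigma_{\mathcal{A}}$, $xy$ denotes concatenation ($x\vec{0}=x$, $\vec{0}y=y$). The cylinder set of $x\in\Sigma_{\mathcal{A}}^{\mathrm{fin}}$ is $Z(x)=\{xy:y\in\Sigma_{\mathcal{A}}\}$, and for a finite $F\subseteq\mathcal{A}$ the generalized cylinder set is $Z(x,F)=Z(x)\setminus\bigcup_{e\in F}Z(xe)$. *)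

theory Defs
  imports "HOL-Analysis.Analysis" "HOL-Library.Omega_Words_Fun"
begin

text \<open>Sequences are indexed from 0, so the entry \<open>x\<^sub>i\<close> (\<open>i \<ge> 1\<close>) has index \<open>i - 1\<close>.\<close>

datatype 'a seq = FinSeq "'a list" | InfSeq "nat \<Rightarrow> 'a"

definition Sigma_fin :: "'a set \<Rightarrow> 'a seq set" where
  "Sigma_fin A = FinSeq ` lists A"

definition Sigma_seq :: "'a set \<Rightarrow> 'a seq set" where
  "Sigma_seq A = InfSeq ` (UNIV \<rightarrow> A) \<union> Sigma_fin A"

fun seq_length :: "'a seq \<Rightarrow> enat" where
  "seq_length (FinSeq xs) = enat (length xs)"
| "seq_length (InfSeq f) = \<infinity>"

text \<open>Concatenation is only meaningful when the left argument is finite.\<close>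

fun seq_append :: "'a seq \<Rightarrow> 'a seq \<Rightarrow> 'a seq" where
  "seq_append (FinSeq xs) (FinSeq ys) = FinSeq (xs @ ys)"
| "seq_append (FinSeq xs) (InfSeq g) = InfSeq (conc xs g)"
| "seq_append (InfSeq f) y = InfSeq f"

fun seq_take :: "nat \<Rightarrow> 'a seq \<Rightarrow> 'a seq" where
  "seq_take n (FinSeq xs) = FinSeq (take n xs)"
| "seq_take n (InfSeq f) = FinSeq (map f [0..<n])"

definition cylinder :: "'a set \<Rightarrow> 'a seq \<Rightarrow> 'a seq set" where
  "cylinder A x = {seq_append x y | y. y \<in> Sigma_seq A}"

definition gen_cylinder :: "'a set \<Rightarrow> 'a seq \<Rightarrow> 'a set \<Rightarrow> 'a seq set" where
  "gen_cylinder A x F = cylinder A x - (\<Union>e\<in>F. cylinder A (seq_append x (FinSeq [e])))"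

definition gen_cylinders :: "'a set \<Rightarrow> 'a seq set set" where
  "gen_cylinders A = {gen_cylinder A x F | x F. x \<in> Sigma_fin A \<and> F \<subseteq> A \<and> finite F}"

text \<open>The library's \<^const>\<open>Alexandroff_compactification\<close> represents the point at infinity
  by \<^term>\<open>None\<close>.\<close>

definition X_space :: "'a set \<Rightarrow> (nat \<Rightarrow> 'a option) topology" where
  "X_space A =
     product_topology (\<lambda>_. Alexandroff_compactification (discrete_topology A)) UNIV"

definition Q_map :: "(nat \<Rightarrow> 'a option) \<Rightarrow> 'a seq" where
  "Q_map s =
     (if \<exists>n. s n = None
      then FinSeq (map (\<lambda>i. the (s i)) [0..<(LEAST n. s n = None)])
      else InfSeq (\<lambda>i. the (s i)))"

definition quotient_topology :: "'a topology \<Rightarrow> ('a \<Rightarrow> 'b) \<Rightarrow> 'b topology" where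
  "quotient_topology X f =
     topology (\<lambda>U. U \<subseteq> f ` topspace X \<and> openin X {x \<in> topspace X. f x \<in> U})"

lemma openin_quotient_topology:
  "openin (quotient_topology X f) U \<longleftrightarrow>
     U \<subseteq> f ` topspace X \<and> openin X {x \<in> topspace X. f x \<in> U}"
proof -
  have "istopology (\<lambda>U. U \<subseteq> f ` topspace X \<and> openin X {x \<in> topspace X. f x \<in> U})"
    unfolding istopology_def
  proof (intro conjI allI impI)
    fix S T
    assume "S \<subseteq> f ` topspace X \<and> openin X {x \<in> topspace X. f x \<in> S}"
      and "T \<subseteq> f ` topspace X \<and> openin X {x \<in> topspace X. f x \<in> T}"
    moreover have "{x \<in> topspace X. f x \<in> S \<inter> T} =
        {x \<in> topspace X. f x \<in> S} \<inter> {x \<in> topspace X. f x \<in> T}" by auto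
    ultimately show "S \<inter> T \<subseteq> f ` topspace X" "openin X {x \<in> topspace X. f x \<in> S \<inter> T}"
      by auto
  next
    fix K
    assume K: "\<forall>S\<in>K. S \<subseteq> f ` topspace X \<and> openin X {x \<in> topspace X. f x \<in> S}"
    then show "\<Union>K \<subseteq> f ` topspace X" by auto
    have "{x \<in> topspace X. f x \<in> \<Union>K} = (\<Union>S\<in>K. {x \<in> topspace X. f x \<in> S})" by auto
    then show "openin X {x \<in> topspace X. f x \<in> \<Union>K}" using K by auto
  qed
  then show ?thesis by (simp add: quotient_topology_def)
qed

lemma topspace_quotient_topology [simp]:
  "topspace (quotient_topology X f) = f ` topspace X"
proof (rule antisym)
  show "topspace (quotient_topology X f) \<subseteq> f ` topspace X"
    using openin_quotient_topology by (metis openin_topspace)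
  have "{x \<in> topspace X. f x \<in> f ` topspace X} = topspace X" by auto
  then have "openin (quotient_topology X f) (f ` topspace X)"
    by (simp add: openin_quotient_topology)
  then show "f ` topspace X \<subseteq> topspace (quotient_topology X f)" by (rule openin_subset)
qed

lemma quotient_map_quotient_topology: "quotient_map X (quotient_topology X f) f"
  by (simp add: quotient_map_def openin_quotient_topology)

definition Sigma_topology :: "'a set \<Rightarrow> 'a seq topology" where
  "Sigma_topology A = quotient_topology (X_space A) Q_map"

lemma topspace_X_space: "topspace (X_space A) = UNIV \<rightarrow> insert None (Some ` A)"
  by (simp add: X_space_def PiE_def)

lemma topspace_Sigma_topology: "topspace (Sigma_topology A) = Sigma_seq A"
proof (rule antisym)
  show "topspace (Sigma_topology A) \<subseteq> Sigma_seq A"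
  proof
    fix x assume "x \<in> topspace (Sigma_topology A)"
    then obtain s where "s \<in> UNIV \<rightarrow> insert None (Some ` A)" and x: "x = Q_map s"
      unfolding Sigma_topology_def topspace_quotient_topology topspace_X_space by (rule imageE)
    then have s: "s n \<in> insert None (Some ` A)" for n by (simp only: Pi_iff UNIV_I simp_thms)
    have A: "the (s n) \<in> A" if "s n \<noteq> None" for n using s[of n] that by auto
    show "x \<in> Sigma_seq A"
    proof (cases "\<exists>n. s n = None")
      case True
      have "the (s i) \<in> A" if "i < (LEAST n. s n = None)" for i
        using A[of i] not_less_Least[OF that] by simp
      then have "map (\<lambda>i. the (s i)) [0..<(LEAST n. s n = None)] \<in> lists A" by auto
      with True show ?thesis by (simp add: x Q_map_def Sigma_seq_def Sigma_fin_def)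
    next
      case False
      then show ?thesis using A by (auto simp: x Q_map_def Sigma_seq_def)
    qed
  qed
  show "Sigma_seq A \<subseteq> topspace (Sigma_topology A)"
  proof
    fix x assume "x \<in> Sigma_seq A"
    then consider f where "x = InfSeq f" "\<And>n. f n \<in> A"
      | xs where "x = FinSeq xs" "set xs \<subseteq> A"
      by (auto simp: Sigma_seq_def Sigma_fin_def)
    then have "\<exists>s \<in> UNIV \<rightarrow> insert None (Some ` A). x = Q_map s"
    proof cases
      case 1
      then show ?thesis by (intro bexI[of _ "\<lambda>n. Some (f n)"]) (auto simp: Q_map_def)
    next
      case 2
      define s where "s n = (if n < length xs then Some (xs ! n) else None)" for n
      have "(LEAST n. s n = None) = length xs"
        by (rule Least_equality) (auto simp: s_def split: if_splits)
      moreover have "map (\<lambda>i. the (s i)) [0..<length xs] = xs"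
        by (rule nth_equalityI) (auto simp: s_def)
      moreover have "\<exists>n. s n = None" by (rule exI[of _ "length xs"]) (simp add: s_def)
      ultimately have "x = Q_map s" using 2 by (simp add: Q_map_def)
      moreover have "xs ! n \<in> A" if "n < length xs" for n using 2(2) nth_mem[OF that] by blast
      then have "s \<in> UNIV \<rightarrow> insert None (Some ` A)" by (simp add: s_def)
      ultimately show ?thesis by blast
    qed
    then show "x \<in> topspace (Sigma_topology A)"
      unfolding Sigma_topology_def topspace_quotient_topology topspace_X_space image_iff .
  qed
qed

text \<open>The library's \<^const>\<open>neighbourhood_base_at\<close> says that each neighbourhood of \<open>x\<close> contains a
  neighbourhood in the family, but allows the family to have members that are not neighbourhoods
  of \<open>x\<close>; the first conjunct excludes this.\<close>

definition is_nhd_base :: "'a topology \<Rightarrow> 'a \<Rightarrow> 'a set set \<Rightarrow> bool" where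
  "is_nhd_base X x \<B> \<longleftrightarrow>
     (\<forall>N\<in>\<B>. N \<subseteq> topspace X \<and> (\<exists>U. openin X U \<and> x \<in> U \<and> U \<subseteq> N)) \<and>
     neighbourhood_base_at x (\<lambda>N. N \<in> \<B>) X"

end

theory Submission
  imports Defs
begin

text \<open>The preimage under \<^const>\<open>Q_map\<close> of a generalized cylinder \<open>Z(x, F)\<close> consists of the points of
  the product space whose first \<open>l(x)\<close> coordinates are those of \<open>x\<close> and whose next coordinate
  avoids \<open>F\<close>. It is clopen since each \<open>{a}\<close> is clopen in the one-point compactification, so \<open>Z(x, F)\<close>
  is open and, as the product space is compact, compact.
  For an open \<open>U\<close> containing \<open>x\<close>, the preimage of \<open>U\<close> together with the clopen sets that prescribe one
  letter in position \<open>l(x) + 1\<close> covers the preimage of \<open>Z(x)\<close>; for infinite \<open>x\<close> one takes the clopen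
  sets that deviate from \<open>x\<close> in one position, which cover the whole space. A finite subcover yields a basic neighbourhood of \<open>x\<close> inside \<open>U\<close>.\<close>

section \<open>Entries of sequences and membership in cylinders\<close>

text \<open>The value \<open>None\<close> marks positions past the end. Finite and infinite
  sequences are thus treated alike, and entries compare directly with coordinates in the
  compactified alphabet, where \<open>None\<close> is the point at infinity.\<close>

fun seq_entry :: "'a seq \<Rightarrow> nat \<Rightarrow> 'a option" where
  "seq_entry (FinSeq xs) i = (if i < length xs then Some (xs ! i) else None)"
| "seq_entry (InfSeq f) i = Some (f i)"

lemma FinSeq_in_Sigma_seq [simp]: "FinSeq xs \<in> Sigma_seq A \<longleftrightarrow> set xs \<subseteq> A"
  by (auto simp: Sigma_seq_def Sigma_fin_def)

lemma InfSeq_in_Sigma_seq [simp]: "InfSeq f \<in> Sigma_seq A \<longleftrightarrow> range f \<subseteq> A"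
  by (auto simp: Sigma_seq_def Sigma_fin_def)

lemma cylinder_FinSeq:
  assumes "set xs \<subseteq> A"
  shows "cylinder A (FinSeq xs) =
    {y \<in> Sigma_seq A. \<forall>i<length xs. seq_entry y i = Some (xs ! i)}" (is "_ = ?R")
proof (intro equalityI subsetI)
  fix y assume "y \<in> cylinder A (FinSeq xs)"
  then obtain z where y: "y = seq_append (FinSeq xs) z" and z: "z \<in> Sigma_seq A"
    by (auto simp: cylinder_def)
  show "y \<in> ?R"
  proof (cases z)
    case (FinSeq zs)
    then show ?thesis using y z assms by (auto simp: nth_append)
  next
    case (InfSeq g)
    then show ?thesis using y z assms by (auto simp: conc_def)
  qed
next
  fix y assume y: "y \<in> ?R"
  show "y \<in> cylinder A (FinSeq xs)"
  proof (cases y)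
    case (FinSeq ys)
    \<comment> \<open>If \<open>xs\<close> is nonempty, its last index must carry a defined entry of
      \<open>ys\<close>, which bounds the length.\<close>
    have len: "length xs \<le> length ys"
      using y FinSeq by (cases "length xs") (auto simp: Suc_le_eq split: if_splits)
    have "take (length xs) ys = xs"
      by (rule nth_equalityI) (use y FinSeq len in auto)
    then have "ys = xs @ drop (length xs) ys" by (metis append_take_drop_id)
    moreover have "set (drop (length xs) ys) \<subseteq> A"
      using y FinSeq set_drop_subset by fastforce
    ultimately show ?thesis
      unfolding cylinder_def FinSeq
      by (intro CollectI exI[of _ "FinSeq (drop (length xs) ys)"]) simp
  next
    case (InfSeq g)
    have "g = conc xs (\<lambda>i. g (length xs + i))"
      using y InfSeq by (auto simp: conc_def fun_eq_iff)
    moreover have "range (\<lambda>i. g (length xs + i)) \<subseteq> A" using y InfSeq by auto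
    ultimately show ?thesis
      unfolding cylinder_def InfSeq
      by (intro CollectI exI[of _ "InfSeq (\<lambda>i. g (length xs + i))"]) simp
  qed
qed

text \<open>Inside the cylinder of \<open>xs\<close>, lying in the cylinder of \<open>xs\<close>
  extended by \<open>e\<close> is a condition on the single entry with index
  \<open>length xs\<close>. The entry \<open>None\<close> there, which only \<open>FinSeq xs\<close>
  itself has, is never excluded.\<close>

lemma gen_cylinder_FinSeq:
  assumes "set xs \<subseteq> A" "F \<subseteq> A"
  shows "gen_cylinder A (FinSeq xs) F =
    {y \<in> Sigma_seq A. (\<forall>i<length xs. seq_entry y i = Some (xs ! i)) \<and>
       seq_entry y (length xs) \<notin> Some ` F}"
proof -
  have "cylinder A (seq_append (FinSeq xs) (FinSeq [e])) =
      {y \<in> Sigma_seq A. (\<forall>i<length xs. seq_entry y i = Some (xs ! i)) \<and>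
         seq_entry y (length xs) = Some e}" if "e \<in> F" for e
    using that assms
    by (subst seq_append.simps, subst cylinder_FinSeq) (auto simp: less_Suc_eq nth_append)
  then show ?thesis
    unfolding gen_cylinder_def cylinder_FinSeq[OF assms(1)] by auto
qed

lemma gen_cylinder_empty [simp]: "gen_cylinder A x {} = cylinder A x"
  by (simp add: gen_cylinder_def)

section \<open>Truncation in terms of entries\<close>

text \<open>If \<open>m\<close> is the least index with \<open>s m = None\<close>, the bounded
  condition amounts to \<open>i < m\<close>; if there is no such index, it always holds and nothing
  is cut off.\<close>

lemma seq_entry_Q_map:
  "seq_entry (Q_map s) i = (if \<forall>j\<le>i. s j \<noteq> None then s i else None)"
proof (cases "\<exists>n. s n = None")
  case True
  define m where "m = (LEAST n. s n = None)"
  have m: "s m = None" unfolding m_def using True by (rule LeastI_ex)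
  have "s j \<noteq> None" if "j < m" for j using that not_less_Least unfolding m_def by blast
  then have "(\<forall>j\<le>i. s j \<noteq> None) \<longleftrightarrow> i < m" using m by (meson le_less_trans not_le)
  moreover have "s i = Some (the (s i))" if "\<forall>j\<le>i. s j \<noteq> None" using that by simp
  ultimately show ?thesis using True by (simp add: Q_map_def m_def[symmetric])
next
  case False
  then have "s i = Some (the (s i))" by simp
  moreover have "\<forall>j\<le>i. s j \<noteq> None" using False by simp
  ultimately show ?thesis unfolding Q_map_def if_not_P[OF False] by simp
qed

text \<open>The length can be read off the entries: it is the first index with entry
  \<open>None\<close>, or infinite if there is none.\<close>

lemma seq_entry_eqI: "(\<And>i. seq_entry x i = seq_entry y i) \<Longrightarrow> x = y"
proof (induction x)
  case (FinSeq xs)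
  show ?case
  proof (cases y)
    case FinSeq2: (FinSeq ys)
    \<comment> \<open>Each list has entry \<open>None\<close> at its own length, so neither can be
      longer than the other.\<close>
    have "length xs = length ys"
      using FinSeq[of "length xs"] FinSeq[of "length ys"] FinSeq2
      by (auto split: if_splits)
    moreover have "xs ! i = ys ! i" if "i < length xs" for i
      using FinSeq[of i] FinSeq2 that calculation by simp
    ultimately show ?thesis using FinSeq2 by (simp add: list_eq_iff_nth_eq)
  next
    case (InfSeq g)
    then show ?thesis using FinSeq[of "length xs"] by simp
  qed
next
  case (InfSeq f)
  show ?case
  proof (cases y)
    case (FinSeq ys)
    then show ?thesis using InfSeq[of "length ys"] by simp
  next
    case InfSeq2: (InfSeq g)
    then show ?thesis using InfSeq by auto
  qed
qed

text \<open>Either side excludes \<open>None\<close> below \<open>n\<close>, so truncation leaves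
  these positions unchanged.\<close>

lemma seq_entry_Q_map_prefix:
  "(\<forall>i<n. seq_entry (Q_map s) i = Some (f i)) \<longleftrightarrow> (\<forall>i<n. s i = Some (f i))"
proof
  assume H: "\<forall>i<n. seq_entry (Q_map s) i = Some (f i)"
  show "\<forall>i<n. s i = Some (f i)"
  proof (intro allI impI)
    fix i assume "i < n"
    with H have "seq_entry (Q_map s) i = Some (f i)" by blast
    then show "s i = Some (f i)" by (simp add: seq_entry_Q_map split: if_splits)
  qed
qed (auto simp: seq_entry_Q_map)

lemma Q_map_eq_FinSeq:
  assumes "\<forall>i<length xs. s i = Some (xs ! i)" "s (length xs) = None"
  shows "Q_map s = FinSeq xs"
proof (rule seq_entry_eqI)
  fix i
  show "seq_entry (Q_map s) i = seq_entry (FinSeq xs) i"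
    using assms by (auto simp: seq_entry_Q_map not_less)
qed

lemma Q_map_eq_InfSeq: "(\<And>i. s i = Some (f i)) \<Longrightarrow> Q_map s = InfSeq f"
  by (rule seq_entry_eqI) (simp add: seq_entry_Q_map)

section \<open>Clopen preimages; openness and compactness of generalized cylinders\<close>

lemma continuous_map_Q_map: "continuous_map (X_space A) (Sigma_topology A) Q_map"
  unfolding Sigma_topology_def
  by (rule quotient_imp_continuous_map[OF quotient_map_quotient_topology])

lemma Q_map_image: "Q_map ` topspace (X_space A) = Sigma_seq A"
  using topspace_Sigma_topology[of A] by (simp add: Sigma_topology_def)

lemma Q_map_in_Sigma_seq: "s \<in> topspace (X_space A) \<Longrightarrow> Q_map s \<in> Sigma_seq A"
  using Q_map_image by blast

lemma compact_space_X_space: "compact_space (X_space A)"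
  by (simp add: X_space_def compact_space_product_topology)

text \<open>Building blocks: preimages of generalized cylinders are finite Boolean combinations of
  these sets.\<close>

definition letter_set :: "'a set \<Rightarrow> nat \<Rightarrow> 'a \<Rightarrow> (nat \<Rightarrow> 'a option) set" where
  "letter_set A i a = {s \<in> topspace (X_space A). s i = Some a}"

text \<open>In the discrete space a singleton is open, closed and compact, so its copy in the
  one-point compactification is clopen. Both properties pull back along the projection to coordinate
  \<open>i\<close>.\<close>

lemma
  assumes "a \<in> A"
  shows openin_letter_set: "openin (X_space A) (letter_set A i a)"
    and closedin_letter_set: "closedin (X_space A) (letter_set A i a)"
proof -
  let ?Y = "Alexandroff_compactification (discrete_topology A)"
  have cont: "continuous_map (X_space A) ?Y (\<lambda>s. s i)"
    unfolding X_space_def by (rule continuous_map_product_projection) simp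
  have eq: "letter_set A i a = {s \<in> topspace (X_space A). s i \<in> Some ` {a}}"
    by (auto simp: letter_set_def)
  have "openin ?Y (Some ` {a})"
    unfolding openin_Alexandroff_compactification_image_Some using assms by simp
  then show "openin (X_space A) (letter_set A i a)"
    unfolding eq by (rule openin_continuous_map_preimage[OF cont])
  have "closedin ?Y (Some ` {a})"
    unfolding closedin_Alexandroff_compactification_image_Some using assms by simp
  then show "closedin (X_space A) (letter_set A i a)"
    unfolding eq by (rule closedin_continuous_map_preimage[OF cont])
qed

lemma Q_map_preimage_gen_cylinder:
  assumes "set xs \<subseteq> A" "F \<subseteq> A"
  shows "{s \<in> topspace (X_space A). Q_map s \<in> gen_cylinder A (FinSeq xs) F} =
    {s \<in> topspace (X_space A). (\<forall>i<length xs. s i = Some (xs ! i)) \<and> s (length xs) \<notin> Some ` F}"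
proof -
  \<comment> \<open>With no \<open>None\<close> among the first \<open>length xs\<close>
    coordinates, the next entry equals the next coordinate, also when that is
    \<open>None\<close>.\<close>
  have "seq_entry (Q_map s) (length xs) = s (length xs)"
    if "\<forall>i<length xs. s i = Some (xs ! i)" for s
    using that by (auto simp: seq_entry_Q_map le_less)
  then show ?thesis
    unfolding gen_cylinder_FinSeq[OF assms]
    by (auto simp: seq_entry_Q_map_prefix Q_map_in_Sigma_seq)
qed

lemma
  assumes "set xs \<subseteq> A" "F \<subseteq> A" "finite F"
  defines "P \<equiv> {s \<in> topspace (X_space A). Q_map s \<in> gen_cylinder A (FinSeq xs) F}"
  shows openin_Q_map_preimage_gen_cylinder: "openin (X_space A) P"
    and closedin_Q_map_preimage_gen_cylinder: "closedin (X_space A) P"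
proof -
  let ?I = "topspace (X_space A) \<inter> (\<Inter>i<length xs. letter_set A i (xs ! i))"
  let ?E = "\<Union>a\<in>F. letter_set A (length xs) a"
  have P: "P = ?I - ?E"
    unfolding P_def Q_map_preimage_gen_cylinder[OF assms(1,2)]
    by (auto simp: letter_set_def)
  have nth: "xs ! i \<in> A" if "i < length xs" for i using assms(1) that nth_mem by blast
  have E: "openin (X_space A) ?E" "closedin (X_space A) ?E"
    using assms by (auto intro!: openin_letter_set closedin_letter_set closedin_Union)
  have I: "openin (X_space A) ?I \<and> closedin (X_space A) ?I"
  \<comment> \<open>For empty \<open>xs\<close> the intersection over \<open>i\<close> is
    \<open>UNIV\<close>, so \<open>?I\<close> is the whole space; otherwise it is a nonempty finite
    intersection of clopen sets.\<close>
  proof (cases "length xs = 0")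
    case False
    then show ?thesis
      by (auto intro!: openin_Int openin_INT2 closedin_Int closedin_INT
          openin_letter_set closedin_letter_set nth)
  qed auto
  show "openin (X_space A) P" unfolding P using I E by (blast intro: openin_diff)
  show "closedin (X_space A) P" unfolding P using I E by (blast intro: closedin_diff)
qed

text \<open>Every point of \<open>Z\<close> is \<open>Q_map s\<close> for some \<open>s\<close>, so
  the inclusion may be checked in the product space.\<close>

lemma Q_map_preimage_subset:
  assumes "Z \<subseteq> Sigma_seq A" "\<And>s. s \<in> topspace (X_space A) \<Longrightarrow> Q_map s \<in> Z \<Longrightarrow> Q_map s \<in> U"
  shows "Z \<subseteq> U"
proof
  fix z assume "z \<in> Z"
  then obtain s where "s \<in> topspace (X_space A)" "z = Q_map s"
    using assms(1) Q_map_image[of A] by blast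
  then show "z \<in> U" using assms(2) \<open>z \<in> Z\<close> by blast
qed

lemma gen_cylinder_subset: "set xs \<subseteq> A \<Longrightarrow> F \<subseteq> A \<Longrightarrow> gen_cylinder A (FinSeq xs) F \<subseteq> Sigma_seq A"
  by (auto simp: gen_cylinder_FinSeq)

lemma
  assumes "set xs \<subseteq> A" "F \<subseteq> A" "finite F"
  shows openin_gen_cylinder: "openin (Sigma_topology A) (gen_cylinder A (FinSeq xs) F)"
    and compactin_gen_cylinder: "compactin (Sigma_topology A) (gen_cylinder A (FinSeq xs) F)"
proof -
  let ?Z = "gen_cylinder A (FinSeq xs) F"
  let ?P = "{s \<in> topspace (X_space A). Q_map s \<in> ?Z}"
  have sub: "?Z \<subseteq> Q_map ` topspace (X_space A)"
    using gen_cylinder_subset[OF assms(1,2)] by (simp add: Q_map_image)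
  show "openin (Sigma_topology A) ?Z"
    unfolding Sigma_topology_def openin_quotient_topology
    using sub openin_Q_map_preimage_gen_cylinder[OF assms] by blast
  have "compactin (X_space A) ?P"
    by (rule closedin_compact_space[OF compact_space_X_space
          closedin_Q_map_preimage_gen_cylinder[OF assms]])
  then have "compactin (Sigma_topology A) (Q_map ` ?P)"
    by (rule image_compactin[OF _ continuous_map_Q_map])
  \<comment> \<open>The preimage maps back onto \<open>?Z\<close> because \<open>Q_map\<close> is
    onto \<open>Sigma_seq A\<close>.\<close>
  moreover have "Q_map ` ?P = ?Z" using sub by blast
  ultimately show "compactin (Sigma_topology A) ?Z" by simp
qed

section \<open>Basic neighbourhoods from finite subcovers\<close>

lemma FinSeq_in_gen_cylinder:
  "set xs \<subseteq> A \<Longrightarrow> F \<subseteq> A \<Longrightarrow> FinSeq xs \<in> gen_cylinder A (FinSeq xs) F"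
  by (auto simp: gen_cylinder_FinSeq)

lemma in_open_Sigma_seq: "openin (Sigma_topology A) U \<Longrightarrow> x \<in> U \<Longrightarrow> x \<in> Sigma_seq A"
  using openin_subset topspace_Sigma_topology by blast

lemma openin_Q_map_preimage:
  "openin (Sigma_topology A) U \<Longrightarrow> openin (X_space A) {s \<in> topspace (X_space A). Q_map s \<in> U}"
  by (rule openin_continuous_map_preimage[OF continuous_map_Q_map])

lemma gen_cylinder_inside_open:
  assumes U: "openin (Sigma_topology A) U" and xs: "FinSeq xs \<in> U"
  obtains F where "F \<subseteq> A" "finite F" "gen_cylinder A (FinSeq xs) F \<subseteq> U"
proof -
  have A: "set xs \<subseteq> A"
    using in_open_Sigma_seq[OF U xs] by simp
  define V where "V = {s \<in> topspace (X_space A). Q_map s \<in> U}"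
  let ?P = "\<lambda>F. {s \<in> topspace (X_space A). Q_map s \<in> gen_cylinder A (FinSeq xs) F}"
  let ?E = "letter_set A (length xs)"
  have comp: "compactin (X_space A) (?P {})"
    by (rule closedin_compact_space[OF compact_space_X_space
          closedin_Q_map_preimage_gen_cylinder]) (use A in auto)
  have cover: "?P {} \<subseteq> \<Union> (insert V (?E ` A))"
  proof
    fix s assume s: "s \<in> ?P {}"
    then have top: "s \<in> topspace (X_space A)" by blast
    have pre: "\<forall>i<length xs. s i = Some (xs ! i)"
      using s unfolding Q_map_preimage_gen_cylinder[OF A empty_subsetI] by blast
    show "s \<in> \<Union> (insert V (?E ` A))"
    proof (cases "s (length xs)")
      \<comment> \<open>Truncation then yields \<open>FinSeq xs\<close> itself, which lies in
        \<open>U\<close>.\<close>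
      case None
      then show ?thesis using Q_map_eq_FinSeq[OF pre] top xs by (auto simp: V_def)
    next
      case (Some a)
      have "s (length xs) \<in> insert None (Some ` A)"
        using top[unfolded topspace_X_space] by (rule Pi_mem) simp
      then have "a \<in> A" using Some by auto
      then show ?thesis using Some top by (auto simp: letter_set_def)
    qed
  qed
  have op: "openin (X_space A) W" if "W \<in> insert V (?E ` A)" for W
    using that openin_Q_map_preimage[OF U, folded V_def] by (auto intro: openin_letter_set)
  have "\<exists>\<F>. finite \<F> \<and> \<F> \<subseteq> insert V (?E ` A) \<and> ?P {} \<subseteq> \<Union>\<F>"
    by (rule compactinD[OF comp op cover])
  then obtain \<F> where \<F>: "finite \<F>" "\<F> \<subseteq> insert V (?E ` A)" "?P {} \<subseteq> \<Union>\<F>"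
    by blast
  \<comment> \<open>The set \<open>F\<close> collects the letters used by the subcover. A point
    whose next coordinate avoids \<open>F\<close> lies in none of their letter sets, so only
    \<open>V\<close> can cover it.\<close>
  obtain F where F: "F \<subseteq> A" "finite F" "\<F> - {V} = ?E ` F"
    using finite_subset_image[of "\<F> - {V}" ?E A] \<F> by blast
  have "gen_cylinder A (FinSeq xs) F \<subseteq> U"
  proof (rule Q_map_preimage_subset[OF gen_cylinder_subset[OF A F(1)]])
    fix s assume top: "s \<in> topspace (X_space A)" and s: "Q_map s \<in> gen_cylinder A (FinSeq xs) F"
    have "s \<in> ?P {}" using top s by (auto simp: gen_cylinder_def)
    then obtain W where W: "W \<in> \<F>" "s \<in> W" using \<F>(3) by blast
    have "s \<in> ?P F" using top s by blast
    then have "s (length xs) \<notin> Some ` F"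
      unfolding Q_map_preimage_gen_cylinder[OF A F(1)] by blast
    then have "W \<notin> ?E ` F" using W(2) by (auto simp: letter_set_def)
    then have "W = V" using W(1) F(3) by blast
    then show "Q_map s \<in> U" using W(2) by (simp add: V_def)
  qed
  then show thesis using F that by blast
qed

lemma in_cylinder_seq_take:
  assumes "range f \<subseteq> A"
  shows "y \<in> cylinder A (seq_take n (InfSeq f)) \<longleftrightarrow>
    y \<in> Sigma_seq A \<and> (\<forall>i<n. seq_entry y i = Some (f i))"
  using assms by (subst seq_take.simps, subst cylinder_FinSeq) auto

lemma cylinder_inside_open:
  assumes U: "openin (Sigma_topology A) U" and f: "InfSeq f \<in> U"
  obtains n where "n \<ge> 1" "cylinder A (seq_take n (InfSeq f)) \<subseteq> U"
proof -
  have A: "range f \<subseteq> A"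
    using in_open_Sigma_seq[OF U f] by simp
  define V where "V = {s \<in> topspace (X_space A). Q_map s \<in> U}"
  define C where "C i = topspace (X_space A) - letter_set A i (f i)" for i
  \<comment> \<open>A point outside every \<open>C i\<close> has all coordinates those of
    \<open>f\<close>; it is mapped to \<open>InfSeq f\<close> and so lies in
    \<open>V\<close>.\<close>
  have cover: "topspace (X_space A) \<subseteq> \<Union> (insert V (range C))"
    using f by (auto simp: V_def C_def letter_set_def Q_map_eq_InfSeq)
  have "openin (X_space A) (C i)" for i
    using closedin_letter_set[of "f i" A i] A by (auto simp: C_def intro: openin_diff)
  then have op: "openin (X_space A) W" if "W \<in> insert V (range C)" for W
    using that openin_Q_map_preimage[OF U, folded V_def] by blast
  have "\<exists>\<F>. finite \<F> \<and> \<F> \<subseteq> insert V (range C) \<and> topspace (X_space A) \<subseteq> \<Union>\<F>"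
    by (rule compactinD[OF compact_space_X_space[unfolded compact_space_def] op cover])
  then obtain \<F> where \<F>: "finite \<F>" "\<F> \<subseteq> insert V (range C)" "topspace (X_space A) \<subseteq> \<Union>\<F>"
    by blast
  obtain I where I: "finite I" "\<F> - {V} = C ` I"
    using finite_subset_image[of "\<F> - {V}" C UNIV] \<F> by blast
  obtain n where n: "I \<subseteq> {..<n}" using finite_nat_bounded[OF I(1)] by blast
  \<comment> \<open>Agreement with \<open>f\<close> below \<open>n\<close> already rules out every
    \<open>C i\<close> with \<open>i\<close> in \<open>I\<close>; passing to \<open>Suc n\<close>
    makes the prefix nonempty, as the index set of the neighbourhood base requires.\<close>
  have "cylinder A (seq_take (Suc n) (InfSeq f)) \<subseteq> U"
  proof (rule Q_map_preimage_subset)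
    show "cylinder A (seq_take (Suc n) (InfSeq f)) \<subseteq> Sigma_seq A"
      using in_cylinder_seq_take[OF A] by blast
    fix s assume top: "s \<in> topspace (X_space A)"
      and s: "Q_map s \<in> cylinder A (seq_take (Suc n) (InfSeq f))"
    obtain W where W: "W \<in> \<F>" "s \<in> W" using \<F>(3) top by blast
    have "\<forall>i<Suc n. s i = Some (f i)"
      using s unfolding in_cylinder_seq_take[OF A] seq_entry_Q_map_prefix by blast
    then have "W \<notin> C ` I" using W(2) n top by (auto simp: C_def letter_set_def)
    then have "W = V" using W(1) I(2) by blast
    then show "Q_map s \<in> U" using W(2) by (simp add: V_def)
  qed
  then show thesis using that[of "Suc n"] by simp
qed

section \<open>The basis and the neighbourhood bases\<close>

text \<open>The members are open, so each \<open>N\<close> serves as its own open set between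
  \<open>x\<close> and \<open>N\<close> in both conjuncts of the definition.\<close>

lemma is_nhd_baseI:
  assumes "\<And>N. N \<in> \<B> \<Longrightarrow> openin X N \<and> x \<in> N"
    and "\<And>U. openin X U \<Longrightarrow> x \<in> U \<Longrightarrow> \<exists>N\<in>\<B>. N \<subseteq> U"
  shows "is_nhd_base X x \<B>"
  unfolding is_nhd_base_def neighbourhood_base_at_def
  by (meson assms openin_subset order_refl)

lemma openin_cylinder_seq_take:
  assumes "range f \<subseteq> A"
  shows "openin (Sigma_topology A) (cylinder A (seq_take n (InfSeq f)))"
  using openin_gen_cylinder[of "map f [0..<n]" A "{}"] assms by auto

lemma InfSeq_in_cylinder:
  "range f \<subseteq> A \<Longrightarrow> InfSeq f \<in> cylinder A (seq_take n (InfSeq f))"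
  by (simp only: in_cylinder_seq_take) simp

lemma gen_cylinders_alt:
  "gen_cylinders A = {gen_cylinder A (FinSeq xs) F | xs F. set xs \<subseteq> A \<and> F \<subseteq> A \<and> finite F}"
  by (fastforce simp: gen_cylinders_def Sigma_fin_def)

lemma gen_cylinders_base:
  assumes U: "openin (Sigma_topology A) U" and x: "x \<in> U"
  shows "\<exists>V. V \<in> gen_cylinders A \<and> x \<in> V \<and> V \<subseteq> U"
proof (cases x)
  case (FinSeq xs)
  have A: "set xs \<subseteq> A"
    using in_open_Sigma_seq[OF U x] FinSeq by simp
  obtain F where F: "F \<subseteq> A" "finite F" "gen_cylinder A (FinSeq xs) F \<subseteq> U"
    by (rule gen_cylinder_inside_open[OF U x[unfolded FinSeq]])
  have "gen_cylinder A x F \<in> gen_cylinders A"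
    unfolding gen_cylinders_alt FinSeq
    by (intro CollectI exI[of _ xs] exI[of _ F]) (simp add: A F)
  then show ?thesis using F(3) FinSeq FinSeq_in_gen_cylinder[OF A F(1)] by blast
next
  case (InfSeq f)
  have A: "range f \<subseteq> A"
    using in_open_Sigma_seq[OF U x] InfSeq by simp
  obtain n where n: "cylinder A (seq_take n (InfSeq f)) \<subseteq> U"
    by (rule cylinder_inside_open[OF U x[unfolded InfSeq]])
  \<comment> \<open>An ordinary cylinder is the generalized cylinder with no excluded
    letters.\<close>
  have "cylinder A (seq_take n (InfSeq f)) \<in> gen_cylinders A"
    unfolding gen_cylinders_alt using A
    by (intro CollectI exI[of _ "map f [0..<n]"] exI[of _ "{}"]) auto
  then show ?thesis using n InfSeq InfSeq_in_cylinder[OF A] by blast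
qed

theorem theorem2p15:
  fixes A :: "'a set"
  assumes "infinite A"
  shows "openin (Sigma_topology A) = arbitrary union_of (\<lambda>U. U \<in> gen_cylinders A)
    \<and> (\<forall>U\<in>gen_cylinders A. openin (Sigma_topology A) U \<and> compactin (Sigma_topology A) U)
    \<and> (\<forall>x\<in>Sigma_seq A. seq_length x = \<infinity> \<longrightarrow>
         is_nhd_base (Sigma_topology A) x {cylinder A (seq_take n x) | n. n \<ge> 1})
    \<and> (\<forall>x\<in>Sigma_seq A. seq_length x < \<infinity> \<longrightarrow>
         is_nhd_base (Sigma_topology A) x {gen_cylinder A x F | F. F \<subseteq> A \<and> finite F})"
proof (intro conjI ballI impI)
  show "openin (Sigma_topology A) = arbitrary union_of (\<lambda>U. U \<in> gen_cylinders A)"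
    \<comment> \<open>This reduces the claim to two facts: members are open, and around each point
      of an open set some member fits inside that set.\<close>
    unfolding openin_topology_base_unique
    using gen_cylinders_base openin_gen_cylinder by (auto simp: gen_cylinders_alt)
next
  fix U assume "U \<in> gen_cylinders A"
  then show "openin (Sigma_topology A) U" "compactin (Sigma_topology A) U"
    using openin_gen_cylinder compactin_gen_cylinder by (auto simp: gen_cylinders_alt)
next
  fix x assume "x \<in> Sigma_seq A" "seq_length x = \<infinity>"
  then obtain f where x: "x = InfSeq f" and A: "range f \<subseteq> A" by (cases x) auto
  show "is_nhd_base (Sigma_topology A) x {cylinder A (seq_take n x) | n. n \<ge> 1}"
  proof (rule is_nhd_baseI)
    fix N assume "N \<in> {cylinder A (seq_take n x) | n. n \<ge> 1}"
    then show "openin (Sigma_topology A) N \<and> x \<in> N"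
      using openin_cylinder_seq_take[OF A] InfSeq_in_cylinder[OF A] x by blast
  next
    fix U assume U: "openin (Sigma_topology A) U" "x \<in> U"
    obtain n where "n \<ge> 1" "cylinder A (seq_take n x) \<subseteq> U"
      unfolding x by (rule cylinder_inside_open[OF U[unfolded x]])
    then show "\<exists>N\<in>{cylinder A (seq_take n x) | n. n \<ge> 1}. N \<subseteq> U"
      by blast
  qed
next
  fix x assume "x \<in> Sigma_seq A" "seq_length x < \<infinity>"
  then obtain xs where x: "x = FinSeq xs" and A: "set xs \<subseteq> A" by (cases x) auto
  show "is_nhd_base (Sigma_topology A) x {gen_cylinder A x F | F. F \<subseteq> A \<and> finite F}"
  proof (rule is_nhd_baseI)
    fix N assume "N \<in> {gen_cylinder A x F | F. F \<subseteq> A \<and> finite F}"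
    then show "openin (Sigma_topology A) N \<and> x \<in> N"
      using openin_gen_cylinder[OF A] FinSeq_in_gen_cylinder[OF A] x by blast
  next
    fix U assume U: "openin (Sigma_topology A) U" "x \<in> U"
    obtain F where "F \<subseteq> A" "finite F" "gen_cylinder A x F \<subseteq> U"
      unfolding x by (rule gen_cylinder_inside_open[OF U[unfolded x]])
    then show "\<exists>N\<in>{gen_cylinder A x F | F. F \<subseteq> A \<and> finite F}. N \<subseteq> U"
      by blast
  qed
qed

end
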